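(* Let $p,q>1$ satisfy $\frac1p+\frac1q=1$, and let $f,g\in C([0,1])$. Suppose that $$\zeta_f^{(p)}\in\ell^p(\mathbb N_{-1}),\qquad \zeta_g^{(q)}\in\ell^q(\mathbb N_{-1}).$$ Then for every dyadic point $t\in\mathbb T$, the dyadic integral $\int_0^t f\,dg:=\lim_{n\to\infty}S_n^L(t;f,g)$ exists.
   Context: $C([0,1])$ denotes the real-valued continuous functions on $[0,1]$. $\mathbb N_0=\{0,1,2,\dots\}$, $\mathbb N_{-1}=\{-1,0,1,\dots\}$. For $n\in\mathbb N_0$: $t_{n,k}=k2^{-n}$ for $0\le k\le 2^n$, $\mathbb T_n=\{t_{n,k}:0\le k\le 2^n\}$, $\mathbb T=\bigcup_{n\ge0}\mathbb T_n$, $I_n=\{0,\dots,2^n-1\}$; for $t\in\mathbb T$, $\ell(t)=\min\{m\ge0:t\in\mathbb T_m\}$. Dyadic left sums: for $f,g\in C([0,1])$, $t\in\mathbb T$, $n\ge\ell(t)$, $$S_n^L(t;f,g)=\sum_{k=0}^{2^nt-1}f(t_{n,k})\big(g(t_{n,k+1})-g(t_{n,k})\big)$$ (empty sum $=0$). The dyadic integral over $[0,t]$ exists if $(S_n^L(t;f,g))_{n\ge\ell(t)}$ converges. Faber--Schauder coefficients of $f\in C([0,1])$: $\theta^f_{-1,0}=f(1)-f(0)$, and for $n\ge0$, $k\in I_n$, $\theta^f_{n,k}=2^{n/2}\big(2f(t_{n+1,2k+1})-f(t_{n,k})-f(t_{n,k+1})\big)$. Level energies ($p>1$): $\zeta_f^{(p)}=(\zeta_f^{(p)}(n))_{n\in\mathbb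 N_{-1}}$ with $\zeta_f^{(p)}(-1)=2^{1-\frac1p}|\theta^f_{-1,0}|$ and $\zeta_f^{(p)}(n)=\big(2^{-np/2}\sum_{k\in I_n}|\theta^f_{n,k}|^p\big)^{1/p}$ for $n\ge0$. *)

theory Defs
  imports "HOL-Analysis.Analysis"
begin

(* Elements of C([0,1]) are represented by functions real => real that are continuous on {0..1}.
   All evaluations relevant to the theory take place inside {0..1}. *)

definition dyadic_pt :: "nat \<Rightarrow> nat \<Rightarrow> real" where
  "dyadic_pt n k = real k / 2 ^ n"

definition dyadics_at :: "nat \<Rightarrow> real set" where
  "dyadics_at n = {dyadic_pt n k | k. k \<le> 2 ^ n}"

definition dyadic_set :: "real set" where
  "dyadic_set = (\<Union>n. dyadics_at n)"

definition dyadic_level :: "real \<Rightarrow> nat" where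
  "dyadic_level t = (LEAST m. t \<in> dyadics_at m)"

(* For t in dyadic_set and n >= dyadic_level t the number 2^n * t is a natural number, so the floor
   is exact there; the sum is only used for such t and n. *)
definition left_sum :: "nat \<Rightarrow> real \<Rightarrow> (real \<Rightarrow> real) \<Rightarrow> (real \<Rightarrow> real) \<Rightarrow> real" where
  "left_sum n t f g =
     (\<Sum>k<nat \<lfloor>2 ^ n * t\<rfloor>. f (dyadic_pt n k) * (g (dyadic_pt n (k + 1)) - g (dyadic_pt n k)))"

(* The sequence of left sums starts at level dyadic_level t, hence the shift of the index. *)
definition has_dyadic_integral ::
    "(real \<Rightarrow> real) \<Rightarrow> (real \<Rightarrow> real) \<Rightarrow> real \<Rightarrow> real \<Rightarrow> bool" where
  "has_dyadic_integral f g t I \<longleftrightarrow> (\<lambda>m. left_sum (dyadic_level t + m) t f g) \<longlonglongrightarrow> I"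

definition dyadic_integrable :: "(real \<Rightarrow> real) \<Rightarrow> (real \<Rightarrow> real) \<Rightarrow> real \<Rightarrow> bool" where
  "dyadic_integrable f g t \<longleftrightarrow> (\<exists>I. has_dyadic_integral f g t I)"

(* Levels are integers n >= -1. The coefficient is meaningful for (n, k) = (-1, 0) and for
   n >= 0, k < 2^n; other arguments are never used. *)
definition fs_coeff :: "(real \<Rightarrow> real) \<Rightarrow> int \<Rightarrow> nat \<Rightarrow> real" where
  "fs_coeff f n k =
     (if n = -1 then f 1 - f 0
      else 2 powr (real_of_int n / 2) *
        (2 * f (dyadic_pt (nat n + 1) (2 * k + 1)) - f (dyadic_pt (nat n) k)
          - f (dyadic_pt (nat n) (k + 1))))"

definition level_energy :: "real \<Rightarrow> (real \<Rightarrow> real) \<Rightarrow> int \<Rightarrow> real" where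
  "level_energy p f n =
     (if n = -1 then 2 powr (1 - 1 / p) * \<bar>fs_coeff f (-1) 0\<bar>
      else (2 powr (- (real_of_int n * p / 2)) *
              (\<Sum>k<2 ^ nat n. \<bar>fs_coeff f n k\<bar> powr p)) powr (1 / p))"

definition ell :: "real \<Rightarrow> 'i set \<Rightarrow> ('i \<Rightarrow> real) set" where
  "ell p A = {x. (\<lambda>i. \<bar>x i\<bar> powr p) summable_on A}"

end

theory Submission
  imports Defs
begin

text \<open>
  Refining the partition from level \<open>n\<close> to level \<open>n + 1\<close> splits each interval \<open>[a, b]\<close> at its
  midpoint \<open>m\<close> and changes its term of the left sum by the product
  \<open>(f m - f a) * (g b - g m)\<close>. By Young's inequality, the whole change is at most
  \<open>V p f (n + 1) + V q g (n + 1)\<close>, where \<open>V p f n\<close> is the sum of the \<open>p\<close>-th powers of the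
  increments of \<open>f\<close> over the dyadic intervals of level \<open>n\<close> (\<open>increment_energy\<close>; see
  lemma \<open>left_sum_refine_bound\<close>). Hence the left sums converge as soon as \<open>V p f\<close> and \<open>V q g\<close> are summable over the levels.

  The hypothesis speaks of second differences instead: for \<open>n \<ge> 0\<close>, the \<open>p\<close>-th power of the level
  energy is the sum \<open>D p f n\<close> (\<open>second_diff_energy\<close>) of \<open>\<bar>2 * f m - f a - f b\<bar> powr p\<close> over
  the intervals of level \<open>n\<close>. The two quantities are linked by the fact that the increments over the two halves of \<open>[a, b]\<close> are
  \<open>((f b - f a) \<plusminus> (2 * f m - f a - f b)) / 2\<close>. If the second difference vanished, the two halves
  would contribute \<open>2 * (1/2) powr p\<close> times the old \<open>p\<close>-th power, and this factor is
  less than \<open>1\<close> because \<open>p > 1\<close>. Weighted convexity of the \<open>p\<close>-th power lets the second difference be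
  added at the price of a slightly larger factor, still less than \<open>1\<close>: thus
  \<open>V p f (n + 1) \<le> r * V p f n + C * D p f n\<close> with \<open>r < 1\<close> (lemma \<open>increment_energy_Suc_le\<close>), and
  summability passes from \<open>D p f\<close> to \<open>V p f\<close>.
\<close>

section \<open>Two facts about real numbers and series\<close>

text \<open>
  This is convexity of the \<open>p\<close>-th power at \<open>x + y = \<theta> * (x / \<theta>) + (1 - \<theta>) * (y / (1 - \<theta>))\<close>. Taking
  \<open>\<theta>\<close> close to \<open>1\<close> makes the factor of \<open>x\<close> as close to \<open>1\<close> as desired.
\<close>

lemma powr_add_weighted_le:
  fixes x y p \<theta> :: real
  assumes "p \<ge> 1" "0 < \<theta>" "\<theta> < 1" "x \<ge> 0" "y \<ge> 0"
  shows "(x + y) powr p \<le> \<theta> powr (1 - p) * x powr p + (1 - \<theta>) powr (1 - p) * y powr p"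
proof -
  have ge1: "c powr (1 - p) \<ge> 1" if "0 < c" "c < 1" for c :: real
    using powr_mono'[of "1 - p" 0 c] that assms(1) by simp
  have scale: "c * (z / c) powr p = c powr (1 - p) * z powr p" if "0 < c" "z \<ge> 0" for c z :: real
    using that by (simp add: powr_divide powr_diff)
  consider "x = 0" | "y = 0" | "x > 0" "y > 0"
    using assms by linarith
  then show ?thesis
  proof cases
    case 1
    then show ?thesis
      using mult_right_mono[OF ge1[of "1 - \<theta>"], of "y powr p"] assms by simp
  next
    case 2
    then show ?thesis
      using mult_right_mono[OF ge1[of \<theta>], of "x powr p"] assms by simp
  next
    case 3
    have "((1 - (1 - \<theta>)) *\<^sub>R (x / \<theta>) + (1 - \<theta>) *\<^sub>R (y / (1 - \<theta>))) powr p
        \<le> (1 - (1 - \<theta>)) * (x / \<theta>) powr p + (1 - \<theta>) * (y / (1 - \<theta>)) powr p"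
      by (rule convex_onD[OF powr_convex[OF assms(1)]]) (use assms 3 in auto)
    then show ?thesis
      using assms 3 scale[of \<theta> x] scale[of "1 - \<theta>" y] by simp
  qed
qed

text \<open>
  Summing the recursion over \<open>n < N\<close> gives
  \<open>(1 - r) * (\<Sum>n<N. v n) \<le> v 0 + C * suminf d\<close>, a bound independent of \<open>N\<close>.
\<close>

lemma summable_if_contractive_recursion:
  fixes v d :: "nat \<Rightarrow> real"
  assumes v: "\<And>n. v n \<ge> 0" and d: "\<And>n. d n \<ge> 0" "summable d"
    and "0 \<le> r" "r < 1" "C \<ge> 0"
    and rec: "\<And>n. v (Suc n) \<le> r * v n + C * d n"
  shows "summable v"
proof (rule summableI_nonneg_bounded)
  fix N
  have "(\<Sum>n<N. v n) \<le> (\<Sum>n<Suc N. v n)"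
    using v by simp
  also have "\<dots> = v 0 + (\<Sum>n<N. v (Suc n))"
    by (rule sum.lessThan_Suc_shift)
  also have "\<dots> \<le> v 0 + (\<Sum>n<N. r * v n + C * d n)"
    by (intro add_left_mono sum_mono rec)
  also have "\<dots> = v 0 + r * (\<Sum>n<N. v n) + C * (\<Sum>n<N. d n)"
    by (simp add: sum.distrib sum_distrib_left)
  also have "\<dots> \<le> v 0 + r * (\<Sum>n<N. v n) + C * suminf d"
    by (intro add_left_mono mult_left_mono sum_le_suminf) (use assms in auto)
  finally have "(1 - r) * (\<Sum>n<N. v n) \<le> v 0 + C * suminf d"
    by (simp add: algebra_simps)
  then show "(\<Sum>n<N. v n) \<le> (v 0 + C * suminf d) / (1 - r)"
    using \<open>r < 1\<close> by (simp add: field_simps)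
qed (rule v)

section \<open>Increments and second differences on the dyadic grid\<close>

lemma sum_lessThan_double:
  fixes h :: "nat \<Rightarrow> 'a::comm_monoid_add"
  shows "(\<Sum>k<2 * N. h k) = (\<Sum>k<N. h (2 * k) + h (2 * k + 1))"
  by (induction N) (simp_all add: algebra_simps)

lemma dyadic_pt_refine [simp]: "dyadic_pt (Suc n) (2 * k) = dyadic_pt n k"
  by (simp add: dyadic_pt_def)

lemma dyadic_pt_refine_Suc [simp]: "dyadic_pt (Suc n) (Suc (Suc (2 * k))) = dyadic_pt n (Suc k)"
  by (simp add: dyadic_pt_def field_simps)

definition increment :: "(real \<Rightarrow> real) \<Rightarrow> nat \<Rightarrow> nat \<Rightarrow> real" where
  "increment f n k = f (dyadic_pt n (k + 1)) - f (dyadic_pt n k)"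

definition second_diff :: "(real \<Rightarrow> real) \<Rightarrow> nat \<Rightarrow> nat \<Rightarrow> real" where
  "second_diff f n k =
     2 * f (dyadic_pt (n + 1) (2 * k + 1)) - f (dyadic_pt n k) - f (dyadic_pt n (k + 1))"

definition increment_energy :: "real \<Rightarrow> (real \<Rightarrow> real) \<Rightarrow> nat \<Rightarrow> real" where
  "increment_energy p f n = (\<Sum>k<2 ^ n. \<bar>increment f n k\<bar> powr p)"

definition second_diff_energy :: "real \<Rightarrow> (real \<Rightarrow> real) \<Rightarrow> nat \<Rightarrow> real" where
  "second_diff_energy p f n = (\<Sum>k<2 ^ n. \<bar>second_diff f n k\<bar> powr p)"

lemma increment_left_half:
  "increment f (Suc n) (2 * k) = (increment f n k + second_diff f n k) / 2"
  by (simp add: increment_def second_diff_def diff_divide_distrib add_divide_distrib)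

lemma increment_right_half:
  "increment f (Suc n) (2 * k + 1) = (increment f n k - second_diff f n k) / 2"
  by (simp add: increment_def second_diff_def diff_divide_distrib add_divide_distrib)

text \<open>
  Convexity is used with weight \<open>3/4\<close> on the increment and \<open>1/4\<close> on the second difference. The two
  halves together contribute the factor \<open>2 * (1/2) powr p = 2 powr (1 - p)\<close>, so a weight \<open>\<theta>\<close> on the
  increment leads to the coefficient \<open>(2 * \<theta>) powr (1 - p)\<close>. For \<open>p > 1\<close> this is less than \<open>1\<close> exactly
  when \<open>\<theta> > 1/2\<close>; the weight \<open>3/4\<close> is one such choice.
\<close>

lemma increment_energy_Suc_le:
  assumes "p \<ge> 1"
  shows "increment_energy p f (Suc n)
    \<le> (3/2) powr (1 - p) * increment_energy p f n + (1/2) powr (1 - p) * second_diff_energy p f n"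
proof -
  have half: "\<bar>z / 2\<bar> powr p \<le> 1 / 2 *
      ((3/2) powr (1 - p) * \<bar>x\<bar> powr p + (1/2) powr (1 - p) * \<bar>y\<bar> powr p)"
    if "\<bar>z\<bar> \<le> \<bar>x\<bar> + \<bar>y\<bar>" for x y z :: real
  proof -
    have "\<bar>z / 2\<bar> powr p \<le> ((\<bar>x\<bar> + \<bar>y\<bar>) / 2) powr p"
      by (rule powr_mono2) (use that assms in auto)
    also have "\<dots> = 1 / 2 * 2 powr (1 - p) * (\<bar>x\<bar> + \<bar>y\<bar>) powr p"
      by (simp add: powr_divide powr_diff)
    also have "\<dots> \<le> 1 / 2 * 2 powr (1 - p) *
        ((3/4) powr (1 - p) * \<bar>x\<bar> powr p + (1/4) powr (1 - p) * \<bar>y\<bar> powr p)"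
      using powr_add_weighted_le[of p "3/4" "\<bar>x\<bar>" "\<bar>y\<bar>"] assms
      by (intro mult_left_mono) auto
    also have "\<dots> = 1 / 2 * ((2 * (3/4)) powr (1 - p) * \<bar>x\<bar> powr p
        + (2 * (1/4)) powr (1 - p) * \<bar>y\<bar> powr p)"
      by (simp only: powr_mult) (simp add: algebra_simps)
    finally show ?thesis
      by simp
  qed
  have "increment_energy p f (Suc n) =
      (\<Sum>k<2 ^ n. \<bar>increment f (Suc n) (2 * k)\<bar> powr p + \<bar>increment f (Suc n) (2 * k + 1)\<bar> powr p)"
    unfolding increment_energy_def power_Suc by (rule sum_lessThan_double)
  also have "\<dots> \<le> (\<Sum>k<2 ^ n. (3/2) powr (1 - p) * \<bar>increment f n k\<bar> powr p
      + (1/2) powr (1 - p) * \<bar>second_diff f n k\<bar> powr p)"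
  proof (rule sum_mono)
    fix k
    show "\<bar>increment f (Suc n) (2 * k)\<bar> powr p + \<bar>increment f (Suc n) (2 * k + 1)\<bar> powr p
        \<le> (3/2) powr (1 - p) * \<bar>increment f n k\<bar> powr p
          + (1/2) powr (1 - p) * \<bar>second_diff f n k\<bar> powr p"
      unfolding increment_left_half increment_right_half
      using half[OF abs_triangle_ineq[of "increment f n k" "second_diff f n k"]]
        half[OF abs_triangle_ineq4[of "increment f n k" "second_diff f n k"]]
      by simp
  qed
  finally show ?thesis
    by (simp add: increment_energy_def second_diff_energy_def sum.distrib sum_distrib_left)
qed

lemma summable_increment_energy:
  assumes "p > 1" "summable (second_diff_energy p f)"
  shows "summable (increment_energy p f)"
proof (rule summable_if_contractive_recursion)
  show "(3/2) powr (1 - p) < 1"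
    using assms(1) powr_less_mono[of "1 - p" 0 "3/2"] by simp
  show "increment_energy p f (Suc n)
      \<le> (3/2) powr (1 - p) * increment_energy p f n + (1/2) powr (1 - p) * second_diff_energy p f n"
    for n
    using increment_energy_Suc_le assms(1) by simp
  show "increment_energy p f n \<ge> 0" "second_diff_energy p f n \<ge> 0" for n
    by (simp_all add: increment_energy_def second_diff_energy_def sum_nonneg)
qed (use assms(2) in simp_all)

section \<open>Level energies\<close>

text \<open>
  The factor \<open>2 powr (n / 2)\<close> in the Faber--Schauder coefficients cancels against the weight
  \<open>2 powr (- n * p / 2)\<close>.
\<close>

lemma level_energy_powr:
  assumes "p > 0"
  shows "level_energy p f (int n) powr p = second_diff_energy p f n"
proof -
  have coeff: "\<bar>fs_coeff f (int n) k\<bar> powr p = 2 powr (real n * p / 2) * \<bar>second_diff f n k\<bar> powr p"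
    for k
    by (simp add: fs_coeff_def second_diff_def abs_mult powr_mult powr_powr)
  have "2 powr (- (real n * p / 2)) * (\<Sum>k<2 ^ n. \<bar>fs_coeff f (int n) k\<bar> powr p)
      = second_diff_energy p f n"
    by (simp add: coeff second_diff_energy_def powr_minus flip: sum_distrib_left)
  moreover have "second_diff_energy p f n \<ge> 0"
    by (simp add: second_diff_energy_def sum_nonneg)
  ultimately show ?thesis
    using assms by (simp add: level_energy_def powr_powr)
qed

lemma summable_second_diff_energy:
  assumes "p > 0" "level_energy p f \<in> ell p {-1..}"
  shows "summable (second_diff_energy p f)"
proof -
  have "(\<lambda>n. \<bar>level_energy p f n\<bar> powr p) summable_on range int"
    using assms(2) by (auto simp: ell_def intro: summable_on_subset_banach)
  then have "((\<lambda>n. \<bar>level_energy p f n\<bar> powr p) \<circ> int) summable_on UNIV"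
    by (subst (asm) summable_on_reindex) auto
  moreover have "(\<lambda>n. \<bar>level_energy p f n\<bar> powr p) \<circ> int = second_diff_energy p f"
    by (auto simp: fun_eq_iff level_energy_powr[OF assms(1), symmetric] level_energy_def)
  ultimately show ?thesis
    by (simp add: summable_on_imp_summable)
qed

section \<open>Refining the left sums\<close>

text \<open>
  The number \<open>N\<close> of intervals replaces the end point \<open>N / 2 ^ n\<close>: refining by one level keeps the end
  point and doubles \<open>N\<close>, so that sums of consecutive levels can be compared without floors.
\<close>

definition grid_left_sum :: "nat \<Rightarrow> nat \<Rightarrow> (real \<Rightarrow> real) \<Rightarrow> (real \<Rightarrow> real) \<Rightarrow> real" where
  "grid_left_sum n N f g = (\<Sum>k<N. f (dyadic_pt n k) * increment g n k)"

lemma left_sum_eq_grid_left_sum: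
  assumes "t = dyadic_pt n N"
  shows "left_sum n t f g = grid_left_sum n N f g"
  using assms by (simp add: left_sum_def grid_left_sum_def increment_def dyadic_pt_def)

text \<open>
  On \<open>[a, b]\<close> with midpoint \<open>m\<close>, refinement replaces \<open>f a * (g b - g a)\<close> by
  \<open>f a * (g m - g a) + f m * (g b - g m)\<close>; what remains in the difference is a product of an
  increment of \<open>f\<close> over the left half and one of \<open>g\<close> over the right half.
\<close>

lemma grid_left_sum_refine:
  "grid_left_sum (Suc n) (2 * N) f g - grid_left_sum n N f g
     = (\<Sum>k<N. increment f (Suc n) (2 * k) * increment g (Suc n) (2 * k + 1))"
  unfolding grid_left_sum_def sum_lessThan_double sum_subtractf[symmetric]
  by (rule sum.cong) (simp_all add: increment_def left_diff_distrib right_diff_distrib)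

text \<open>
  Young's inequality bounds each product; the increments of \<open>f\<close> over right halves, those of \<open>g\<close> over
  left halves, and all those beyond the end point are then added to complete the two energies.
\<close>

lemma left_sum_refine_bound:
  assumes "p > 1" "q > 1" "1 / p + 1 / q = 1" "N \<le> 2 ^ n"
  shows "\<bar>grid_left_sum (Suc n) (2 * N) f g - grid_left_sum n N f g\<bar>
    \<le> increment_energy p f (Suc n) + increment_energy q g (Suc n)"
proof -
  let ?F = "\<lambda>k. \<bar>increment f (Suc n) k\<bar> powr p"
  let ?G = "\<lambda>k. \<bar>increment g (Suc n) k\<bar> powr q"
  have "\<bar>grid_left_sum (Suc n) (2 * N) f g - grid_left_sum n N f g\<bar>
      \<le> (\<Sum>k<N. \<bar>increment f (Suc n) (2 * k)\<bar> * \<bar>increment g (Suc n) (2 * k + 1)\<bar>)"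
    unfolding grid_left_sum_refine abs_mult[symmetric] by (rule sum_abs)
  also have "\<dots> \<le> (\<Sum>k<N. ?F (2 * k) + ?G (2 * k + 1))"
  proof (rule sum_mono)
    fix k
    have "\<bar>increment f (Suc n) (2 * k)\<bar> * \<bar>increment g (Suc n) (2 * k + 1)\<bar>
        \<le> ?F (2 * k) / p + ?G (2 * k + 1) / q"
      by (rule Youngs_inequality) (use assms in auto)
    also have "\<dots> \<le> ?F (2 * k) + ?G (2 * k + 1)"
      using assms by (intro add_mono) (simp_all add: divide_le_eq mult_le_cancel_left1)
    finally show "\<bar>increment f (Suc n) (2 * k)\<bar> * \<bar>increment g (Suc n) (2 * k + 1)\<bar>
        \<le> ?F (2 * k) + ?G (2 * k + 1)" .
  qed
  also have "\<dots> \<le> (\<Sum>k<2 ^ n. ?F (2 * k) + ?G (2 * k + 1))"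
    by (rule sum_mono2) (use assms in auto)
  also have "\<dots> \<le> (\<Sum>k<2 ^ n. (?F (2 * k) + ?G (2 * k)) + (?F (2 * k + 1) + ?G (2 * k + 1)))"
    by (rule sum_mono) simp
  also have "\<dots> = (\<Sum>k<2 * 2 ^ n. ?F k + ?G k)"
    by (rule sum_lessThan_double[symmetric])
  also have "\<dots> = increment_energy p f (Suc n) + increment_energy q g (Suc n)"
    by (simp add: increment_energy_def sum.distrib)
  finally show ?thesis .
qed

section \<open>Existence of the dyadic integral\<close>

lemma dyadic_set_at_level:
  assumes "t \<in> dyadic_set"
  obtains N where "N \<le> 2 ^ dyadic_level t" "t = dyadic_pt (dyadic_level t) N"
proof -
  have "\<exists>m. t \<in> dyadics_at m"
    using assms by (simp add: dyadic_set_def)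
  then have "t \<in> dyadics_at (dyadic_level t)"
    unfolding dyadic_level_def by (rule LeastI_ex)
  then show ?thesis
    using that by (auto simp: dyadics_at_def)
qed

theorem corollary3p6:
  fixes p q :: real and f g :: "real \<Rightarrow> real"
  assumes "p > 1" and "q > 1" and "1 / p + 1 / q = 1"
    and "continuous_on {0..1} f" and "continuous_on {0..1} g"
    and "level_energy p f \<in> ell p {-1..}"
    and "level_energy q g \<in> ell q {-1..}"
  shows "\<forall>t\<in>dyadic_set. dyadic_integrable f g t"
proof
  fix t assume "t \<in> dyadic_set"
  define l where "l = dyadic_level t"
  obtain N where N: "N \<le> 2 ^ l" "t = dyadic_pt l N"
    using dyadic_set_at_level[OF \<open>t \<in> dyadic_set\<close>] unfolding l_def .
  define S where "S m = left_sum (l + m) t f g" for m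
  define E where "E n = increment_energy p f n + increment_energy q g n" for n
  have S_grid: "S m = grid_left_sum (l + m) (2 ^ m * N) f g" for m
    unfolding S_def by (rule left_sum_eq_grid_left_sum) (simp add: N dyadic_pt_def power_add)
  have bound: "\<bar>S (Suc m) - S m\<bar> \<le> E (m + Suc l)" for m
  proof -
    have "2 ^ m * N \<le> 2 ^ (l + m)"
      using N by (simp add: power_add mult.commute)
    from left_sum_refine_bound[OF assms(1-3) this] show ?thesis
      by (simp add: S_grid E_def ac_simps)
  qed
  have "summable E"
    unfolding E_def
    by (intro summable_add summable_increment_energy summable_second_diff_energy)
      (use assms in auto)
  then have "summable (\<lambda>m. E (m + Suc l))"
    by (rule summable_ignore_initial_segment)
  then have "summable (\<lambda>m. S (Suc m) - S m)"
    by (rule summable_comparison_test'[where N = 0]) (simp only: real_norm_def bound)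
  then have "(\<lambda>n. \<Sum>m<n. S (Suc m) - S m) \<longlonglongrightarrow> (\<Sum>m. S (Suc m) - S m)"
    by (rule summable_LIMSEQ)
  then have "(\<lambda>n. S n - S 0 + S 0) \<longlonglongrightarrow> (\<Sum>m. S (Suc m) - S m) + S 0"
    unfolding sum_lessThan_telescope by (intro tendsto_add tendsto_const)
  then have "S \<longlonglongrightarrow> (\<Sum>m. S (Suc m) - S m) + S 0"
    by simp
  then show "dyadic_integrable f g t"
    unfolding dyadic_integrable_def has_dyadic_integral_def S_def l_def by blast
qed

end
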